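(* (a) Let $A$ be a set with $1\leq|A|\leq\omega$, and for each $\alpha\in A$ let $\mathbf{F}(\alpha)$ be a $\pi$-tree on a topological space $X_\alpha$. Suppose that for each $\alpha\in A$ there is $\gamma_\alpha\subseteq\mathcal{P}(\omega)$ such that $|\gamma_\alpha|\leq\omega$, $\gamma_\alpha$ has the finite intersection property, and $\gamma_\alpha\gg\mathrm{Rise}_{\mathbf{F}(\alpha)}(X_\alpha)$. Then the Tychonoff product $\prod_{\alpha\in A}X_\alpha$ has a $\pi$-tree. (b) Suppose, in addition to the hypotheses of (a), that $\mathbf{G}$ is a $\pi$-tree on a topological space $Y$ and $\mathrm{Rise}_{\mathbf{G}}(Y)$ has the finite intersection property. Then the Tychonoff product $Y\times\prod_{\alpha\in A}X_\alpha$ has a $\pi$-tree.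
   Context: A family has the finite intersection property if every finite nonempty subfamily has nonempty intersection. Neighbourhoods are not necessarily open. $\omega=\{0,1,2,\dots\}$, ${}^{<\omega}\omega$ is the set of finite sequences of natural numbers. A tree is a strict partial order in which the set of predecessors of every node is well-ordered; $\mathrm{height}(x)$ is the ordinal isomorphic to the set of predecessors of $x$; a branch is a maximal chain; $\mathrm{sons}(x)$ is the set of immediate successors of $x$; $0$ denotes the least node. A foliage tree is a pair $\mathbf{F}=(T,l)$ with $T$ a tree (skeleton) and $l$ a function on its nodes, $\mathbf{F}_x:=l(x)$; tree notions apply via the skeleton. $\mathrm{shoot}_{\mathbf{F}}(v)=\{\bigcup_{x\in C}\mathbf{F}_x: C\text{ a cofinite subset of }\mathrm{sons}_{\mathbf{F}}(v)\}$; $\mathrm{scope}_{\mathbf{F}}(p)=\{x:p\in\mathbf{F}_x\}$. For families $\gamma,\delta$ of sets, $\gamma\gg\delta$ means every nonempty $D\in\delta$ contains some nonempty $G\in\gamma$. $\mathrm{rise}_{\mathbf{F}}(p,U)=\{\mathrm{height}_{\mathbf{F}}(v): v\in\mathrm{scope}_{\mathbf{F}}(p),\ \mathrm{shoot}_{\mathbf{F}}(v)\gg\{U\}\}$; $\mathrm{Rise}_{\mathbf{F}}(X)=\{\mathrm{rise}_{\mathbf{F}}(p,U):p\in X,\ U\text{ a neighbourhood of }p\text{ in }X\}$. $\mathbf{F}$ is locally strict if each non-maximal leaf $\mathbf{F}_x$ is the disjoint union of $\mathbf{F}_s$, $s\in\mathrm{sons}(x)$; has strict branches if it has a node and for each branch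 $B$, $\bigcap_{x\in B}\mathbf{F}_x$ is a singleton; is open in $X$ if all leaves are open in $X$; is a foliage $\omega,\omega$-tree if its skeleton is order-isomorphic to $({}^{<\omega}\omega,\subsetneq)$. A Baire foliage tree on $X$ is an open in $X$, locally strict foliage $\omega,\omega$-tree with strict branches and $\mathbf{F}_{0_{\mathbf{F}}}=X$. $\mathbf{F}$ grows into $X$ if for every $p\in X$ and neighbourhood $U$ of $p$ there is $z\in\mathrm{scope}_{\mathbf{F}}(p)$ with $\mathrm{shoot}_{\mathbf{F}}(z)\gg\{U\}$. A $\pi$-tree on $X$ is a Baire foliage tree on $X$ that grows into $X$; a space has a $\pi$-tree if there is a $\pi$-tree on it. *)

theory Defs
  imports "HOL-Analysis.Analysis" "HOL-Library.Sublist"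
begin

text \<open>Foliage omega,omega-trees: the skeleton is (nat list, strict_prefix), which is
  order-isomorphic to the tree of finite sequences of natural numbers ordered by
  proper extension; a foliage tree is then just its leaf function.\<close>

definition sons :: "nat list \<Rightarrow> nat list set" where
  "sons s = {t. strict_prefix s t \<and> length t = Suc (length s)}"

definition height :: "nat list \<Rightarrow> nat" where
  "height s = card {t. strict_prefix t s}"

definition tchain :: "nat list set \<Rightarrow> bool" where
  "tchain B \<longleftrightarrow> (\<forall>x\<in>B. \<forall>y\<in>B. x = y \<or> strict_prefix x y \<or> strict_prefix y x)"

definition branch :: "nat list set \<Rightarrow> bool" where
  "branch B \<longleftrightarrow> tchain B \<and> (\<forall>C. tchain C \<and> B \<subseteq> C \<longrightarrow> C = B)"

definition shoot :: "(nat list \<Rightarrow> 'a set) \<Rightarrow> nat list \<Rightarrow> 'a set set" where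
  "shoot F v = {(\<Union>x\<in>C. F x) | C. C \<subseteq> sons v \<and> finite (sons v - C)}"

definition scope :: "(nat list \<Rightarrow> 'a set) \<Rightarrow> 'a \<Rightarrow> nat list set" where
  "scope F p = {x. p \<in> F x}"

definition gg :: "'a set set \<Rightarrow> 'a set set \<Rightarrow> bool" (infix "\<ggreater>" 50) where
  "gg \<gamma> \<delta> \<longleftrightarrow> (\<forall>D\<in>\<delta>. D \<noteq> {} \<longrightarrow> (\<exists>G\<in>\<gamma>. G \<noteq> {} \<and> G \<subseteq> D))"

definition nbhd :: "'a topology \<Rightarrow> 'a \<Rightarrow> 'a set \<Rightarrow> bool" where
  "nbhd X p U \<longleftrightarrow> U \<subseteq> topspace X \<and> p \<in> X interior_of U"

definition rise :: "(nat list \<Rightarrow> 'a set) \<Rightarrow> 'a \<Rightarrow> 'a set \<Rightarrow> nat set" where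
  "rise F p U = {height v | v. v \<in> scope F p \<and> shoot F v \<ggreater> {U}}"

definition Rise :: "(nat list \<Rightarrow> 'a set) \<Rightarrow> 'a topology \<Rightarrow> nat set set" where
  "Rise F X = {rise F p U | p U. p \<in> topspace X \<and> nbhd X p U}"

definition fip :: "'a set set \<Rightarrow> bool" where
  "fip \<gamma> \<longleftrightarrow> (\<forall>S. finite S \<and> S \<noteq> {} \<and> S \<subseteq> \<gamma> \<longrightarrow> \<Inter>S \<noteq> {})"

text \<open>Every node of the omega,omega-tree is non-maximal.\<close>
definition locally_strict :: "(nat list \<Rightarrow> 'a set) \<Rightarrow> bool" where
  "locally_strict F \<longleftrightarrow>
     (\<forall>x. F x = (\<Union>s\<in>sons x. F s) \<and> disjoint_family_on F (sons x))"

definition strict_branches :: "(nat list \<Rightarrow> 'a set) \<Rightarrow> bool" where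
  "strict_branches F \<longleftrightarrow> (\<forall>B. branch B \<longrightarrow> (\<exists>q. (\<Inter>x\<in>B. F x) = {q}))"

definition open_foliage :: "'a topology \<Rightarrow> (nat list \<Rightarrow> 'a set) \<Rightarrow> bool" where
  "open_foliage X F \<longleftrightarrow> (\<forall>x. openin X (F x))"

definition baire_foliage_tree :: "'a topology \<Rightarrow> (nat list \<Rightarrow> 'a set) \<Rightarrow> bool" where
  "baire_foliage_tree X F \<longleftrightarrow>
     open_foliage X F \<and> locally_strict F \<and> strict_branches F \<and> F [] = topspace X"

definition grows_into :: "(nat list \<Rightarrow> 'a set) \<Rightarrow> 'a topology \<Rightarrow> bool" where
  "grows_into F X \<longleftrightarrow>
     (\<forall>p\<in>topspace X. \<forall>U. nbhd X p U \<longrightarrow> (\<exists>z\<in>scope F p. shoot F z \<ggreater> {U}))"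

definition pi_tree :: "'a topology \<Rightarrow> (nat list \<Rightarrow> 'a set) \<Rightarrow> bool" where
  "pi_tree X F \<longleftrightarrow> baire_foliage_tree X F \<and> grows_into F X"

definition has_pi_tree :: "'a topology \<Rightarrow> bool" where
  "has_pi_tree X \<longleftrightarrow> (\<exists>F. pi_tree X F)"

end

theory Submission imports Defs begin

text \<open>A Baire foliage tree on a space identifies it with the Baire space: a point corresponds
  to its code, the infinite sequence of which all leaves containing the point are initial segments.
  A level \<open>n\<close> lies in \<open>rise F p U\<close> iff \<open>U\<close> contains all
  points whose code agrees with that of \<open>p\<close> below \<open>n\<close> and has a large digit at
  \<open>n\<close>. Shrinking neighbourhoods shows that the members of a \<open>Rise\<close> family, and the finite
  intersections from \<open>\<gamma>\<^sub>\<alpha>\<close>, are infinite; since \<open>\<gamma>\<^sub>\<alpha>\<close> is countable,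
  it has an infinite pseudo-intersection, a sequence \<open>h\<^sub>\<alpha>\<close> of levels almost all of which
  work for any given neighbourhood in \<open>X\<^sub>\<alpha>\<close>.

  At stage \<open>m\<close> the tree on the product fixes the code below \<open>h\<^sub>\<alpha>(m)\<close> for finitely many
  \<open>\<alpha>\<close>, and below \<open>m\<close> in \<open>Y\<close>. Each such box is split in two steps: first according to
  the minimum \<open>k\<close> of the next digits, so that cofinitely many sons have all next digits large,
  and then into the boxes of stage \<open>m + 1\<close>.\<close>

section \<open>Sons, heights and branches of the tree of finite sequences\<close>

lemma sons_eq: "sons s = range (\<lambda>i. s @ [i])"
proof -
  have "\<exists>i. t = s @ [i]" if "strict_prefix s t" "length t = Suc (length s)" for t
  proof -
    from that obtain u where u: "t = s @ u" by (auto simp: strict_prefix_def prefix_def)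
    with that(2) have "length u = Suc 0" by simp
    then show ?thesis using u by (auto simp: length_Suc_conv)
  qed
  then show ?thesis by (auto simp: sons_def strict_prefix_def)
qed

lemma height_eq_length: "height s = length s"
proof -
  have "{t. strict_prefix t s} = (\<lambda>n. take n s) ` {..<length s}"
  proof (intro set_eqI iffI)
    fix t assume "t \<in> {t. strict_prefix t s}"
    then obtain u where u: "s = t @ u" "u \<noteq> []" by (auto simp: strict_prefix_def prefix_def)
    then have "t = take (length t) s" "length t < length s" by auto
    then show "t \<in> (\<lambda>n. take n s) ` {..<length s}" by blast
  next
    fix t assume "t \<in> (\<lambda>n. take n s) ` {..<length s}"
    then obtain n where n: "t = take n s" "n < length s" by auto
    then have "length t \<noteq> length s" by simp
    then show "t \<in> {t. strict_prefix t s}" using n take_is_prefix[of n s] by (auto simp: strict_prefix_def)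
  qed
  moreover have "inj_on (\<lambda>n. take n s) {..<length s}"
  proof (rule inj_onI)
    fix a b assume "a \<in> {..<length s}" "b \<in> {..<length s}" "take a s = take b s"
    then have "length (take a s) = length (take b s)" by simp
    then show "a = b" using \<open>a \<in> _\<close> \<open>b \<in> _\<close> by simp
  qed
  ultimately show ?thesis by (simp add: height_def card_image)
qed

lemma prefix_initial_segments: "n \<le> m \<Longrightarrow> prefix (map f [0..<n]) (map f [0..<m])"
proof -
  assume "n \<le> m"
  then have "map f [0..<n] = take n (map f [0..<m])" by (simp add: take_map)
  then show ?thesis using take_is_prefix by metis
qed

lemma tchain_initial_segments: "tchain (range (\<lambda>n. map f [0..<n]))"
proof -
  have "map f [0..<n] = map f [0..<m] \<or> strict_prefix (map f [0..<n]) (map f [0..<m])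
      \<or> strict_prefix (map f [0..<m]) (map f [0..<n])" for n m
    using prefix_initial_segments[of n m f] prefix_initial_segments[of m n f]
    by (cases "n \<le> m") (auto simp: strict_prefix_def)
  then show ?thesis unfolding tchain_def by blast
qed

text \<open>Maximality: a node of a larger chain is comparable with the initial segment of
  \<open>f\<close> of the same length, and comparable sequences of equal length coincide.\<close>

lemma branch_initial_segments: "branch (range (\<lambda>n. map f [0..<n]))"
  unfolding branch_def
proof (intro conjI allI impI tchain_initial_segments)
  fix C assume C: "tchain C \<and> range (\<lambda>n. map f [0..<n]) \<subseteq> C"
  have "x \<in> range (\<lambda>n. map f [0..<n])" if "x \<in> C" for x
  proof -
    define y where "y = map f [0..<length x]"
    have "y \<in> C" "length y = length x" using C by (auto simp: y_def)
    then have "x = y"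
      using C that prefix_length_less[of x y] prefix_length_less[of y x] by (force simp: tchain_def)
    then have "x = map f [0..<length x]" by (simp only: y_def)
    then show ?thesis by blast
  qed
  then show "C = range (\<lambda>n. map f [0..<n])" using C by blast
qed

text \<open>A maximal chain has members of unbounded length, because a longest member could be
  prolonged by one more digit. Its members are prefixes of each other, so they agree wherever they
  are defined, and \<open>f\<close> is their common extension.\<close>

lemma branch_eq_initial_segments:
  assumes "branch B"
  obtains f where "B = range (\<lambda>n. map f [0..<n])"
proof -
  have chain: "tchain B" and maxl: "\<And>C. tchain C \<Longrightarrow> B \<subseteq> C \<Longrightarrow> C = B"
    using assms by (auto simp: branch_def)
  have cmp: "prefix x y" if "x \<in> B" "y \<in> B" "length x \<le> length y" for x y
    using chain that prefix_length_less[of y x] unfolding tchain_def strict_prefix_def by force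
  have unbdd: "\<exists>x\<in>B. n < length x" for n
  proof (rule ccontr)
    assume "\<not> ?thesis"
    then have bdd: "\<forall>x. x \<in> B \<longrightarrow> length x < Suc n" by auto
    have "B \<noteq> {}" using maxl[of "{[]}"] by (auto simp: tchain_def)
    then obtain x0 where "x0 \<in> B" by blast
    from ex_has_greatest_nat[of "\<lambda>x. x \<in> B", OF this bdd]
    obtain x where x: "x \<in> B" and mx: "\<And>y. y \<in> B \<Longrightarrow> length y \<le> length x" by blast
    have px: "prefix y x" if "y \<in> B" for y using cmp[OF that x mx[OF that]] .
    have "strict_prefix y (x @ [0])" if "y \<in> B" for y
      using px[OF that] by (auto simp: strict_prefix_def prefix_def)
    then have "tchain (insert (x @ [0]) B)"
      using chain by (auto simp: tchain_def)
    then have "x @ [0] \<in> B" using maxl by blast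
    from mx[OF this] show False by simp
  qed
  define pick where "pick n = (SOME x. x \<in> B \<and> n < length x)" for n
  have pick: "pick n \<in> B" "n < length (pick n)" for n
    using someI_ex[of "\<lambda>x. x \<in> B \<and> n < length x"] unbdd[of n] unfolding pick_def by blast+
  define f where "f n = pick n ! n" for n
  have f: "f n = x ! n" if "x \<in> B" "n < length x" for x n
  proof (cases "length x \<le> length (pick n)")
    case True
    then show ?thesis using cmp[OF that(1) pick(1) True] that by (auto simp: f_def prefix_def nth_append)
  next
    case False
    then have "prefix (pick n) x" using cmp[OF pick(1) that(1)] by simp
    then show ?thesis using pick(2)[of n] by (auto simp: f_def prefix_def nth_append)
  qed
  have "B \<subseteq> range (\<lambda>n. map f [0..<n])"
  proof
    fix x assume "x \<in> B"
    then have "x = map f [0..<length x]" using f by (auto intro!: nth_equalityI)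
    then show "x \<in> range (\<lambda>n. map f [0..<n])" by blast
  qed
  moreover have "tchain (range (\<lambda>n. map f [0..<n]))"
    by (rule tchain_initial_segments)
  ultimately show thesis using maxl that by blast
qed


section \<open>Baire foliage trees as codings by the Baire space\<close>

text \<open>The leaves are the preimages of the standard cylinders of the Baire space under the code
  map \<open>e\<close>. Bijectivity of \<open>e\<close> is what strict branches amount to.\<close>

definition coded_by :: "'a topology \<Rightarrow> (nat list \<Rightarrow> 'a set) \<Rightarrow> ('a \<Rightarrow> nat \<Rightarrow> nat) \<Rightarrow> bool" where
  "coded_by X F e \<longleftrightarrow> bij_betw e (topspace X) UNIV
     \<and> (\<forall>s. F s = {x \<in> topspace X. \<forall>i<length s. e x i = s ! i})"

lemma coded_by_surj:
  assumes "coded_by X F e"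
  obtains x where "x \<in> topspace X" "e x = f"
  using assms unfolding coded_by_def bij_betw_def by (metis UNIV_I imageE)

lemma coded_by_inj:
  assumes "coded_by X F e" "x \<in> topspace X" "y \<in> topspace X" "e x = e y"
  shows "x = y"
  using assms unfolding coded_by_def bij_betw_def inj_on_def by blast

lemma coded_by_mem:
  assumes "coded_by X F e"
  shows "x \<in> F s \<longleftrightarrow> x \<in> topspace X \<and> (\<forall>i<length s. e x i = s ! i)"
  using assms unfolding coded_by_def by blast

lemma coded_by_leaf_nonempty:
  assumes "coded_by X F e"
  shows "F s \<noteq> {}"
proof -
  \<comment> \<open>Beyond the length of \<open>s\<close> the value \<open>s ! i\<close> is
    unspecified, which is harmless: membership in the leaf tests only the digits below that
    length.\<close>
  obtain x where "x \<in> topspace X" "e x = (\<lambda>i. s ! i)" using coded_by_surj[OF assms] .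
  then have "x \<in> F s" by (simp add: coded_by_mem[OF assms])
  then show ?thesis by blast
qed

lemma coded_by_mem_snoc:
  assumes "coded_by X F e"
  shows "x \<in> F (s @ [i]) \<longleftrightarrow> x \<in> F s \<and> e x (length s) = i"
  by (auto simp: coded_by_mem[OF assms] nth_append less_Suc_eq)

lemma coded_by_locally_strict:
  assumes "coded_by X F e"
  shows "locally_strict F"
  unfolding locally_strict_def sons_eq disjoint_family_on_def
  by (auto simp: coded_by_mem_snoc[OF assms])

lemma coded_by_strict_branches:
  assumes c: "coded_by X F e"
  shows "strict_branches F"
  unfolding strict_branches_def
proof (intro allI impI)
  fix B assume "branch B"
  then obtain f where B: "B = range (\<lambda>n. map f [0..<n])" by (rule branch_eq_initial_segments)
  obtain q where q: "q \<in> topspace X" "e q = f" using coded_by_surj[OF c] .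
  have "(\<Inter>x\<in>B. F x) = {q}"
  proof (intro set_eqI iffI)
    fix x assume "x \<in> (\<Inter>x\<in>B. F x)"
    then have x: "x \<in> F (map f [0..<n])" for n by (simp add: B)
    then have "x \<in> topspace X" using coded_by_mem[OF c] by blast
    moreover have "e x n = f n" for n
      using x[of "Suc n"] by (auto simp: coded_by_mem[OF c] simp del: upt_Suc)
    ultimately show "x \<in> {q}" using coded_by_inj[OF c _ q(1)] q(2) by auto
  qed (use q in \<open>auto simp: B coded_by_mem[OF c]\<close>)
  then show "\<exists>q. (\<Inter>x\<in>B. F x) = {q}" ..
qed

text \<open>The sons of \<open>v\<close> correspond to the possible next digits, so a cofinite set
  of sons is the complement of a finite set \<open>E\<close> of forbidden digits. For empty
  \<open>U\<close> the left side would hold vacuously.\<close>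

lemma shoot_gg_iff:
  assumes c: "coded_by X F e" and "U \<noteq> {}"
  shows "shoot F v \<ggreater> {U} \<longleftrightarrow> (\<exists>E. finite E \<and> (\<forall>x \<in> F v. e x (length v) \<notin> E \<longrightarrow> x \<in> U))"
proof
  assume "shoot F v \<ggreater> {U}"
  then obtain C where C: "finite (sons v - C)" "\<Union> (F ` C) \<subseteq> U"
    using \<open>U \<noteq> {}\<close> by (auto simp: gg_def shoot_def)
  define E where "E = (\<lambda>i. v @ [i]) -` (sons v - C)"
  have "finite E" unfolding E_def using C(1) by (rule finite_vimageI) (simp add: inj_def)
  moreover have "x \<in> U" if "x \<in> F v" "e x (length v) \<notin> E" for x
  proof -
    have "v @ [e x (length v)] \<in> C" using that(2) by (auto simp: E_def sons_eq)
    moreover have "x \<in> F (v @ [e x (length v)])" using that(1) coded_by_mem_snoc[OF c] by blast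
    ultimately show ?thesis using C(2) by blast
  qed
  ultimately show "\<exists>E. finite E \<and> (\<forall>x \<in> F v. e x (length v) \<notin> E \<longrightarrow> x \<in> U)" by blast
next
  assume "\<exists>E. finite E \<and> (\<forall>x \<in> F v. e x (length v) \<notin> E \<longrightarrow> x \<in> U)"
  then obtain E where E: "finite E" "\<And>x. x \<in> F v \<Longrightarrow> e x (length v) \<notin> E \<Longrightarrow> x \<in> U" by blast
  define C where "C = (\<lambda>i. v @ [i]) ` (- E)"
  have "sons v - C \<subseteq> (\<lambda>i. v @ [i]) ` E" by (auto simp: C_def sons_eq)
  then have "finite (sons v - C)" using E(1) finite_surj by blast
  moreover have "C \<subseteq> sons v" by (auto simp: C_def sons_eq)
  ultimately have "\<Union> (F ` C) \<in> shoot F v" by (auto simp: shoot_def)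
  moreover have "\<Union> (F ` C) \<subseteq> U" using E(2) by (auto simp: C_def coded_by_mem_snoc[OF c])
  \<comment> \<open>Domination asks for a nonempty witness. Some digit avoids the finite set
    \<open>E\<close>, and leaves of a coded tree are nonempty.\<close>
  moreover have "\<Union> (F ` C) \<noteq> {}"
  proof -
    obtain i where "i \<notin> E" using E(1) ex_new_if_finite infinite_UNIV_nat by blast
    then have "F (v @ [i]) \<subseteq> \<Union> (F ` C)" by (auto simp: C_def)
    then show ?thesis using coded_by_leaf_nonempty[OF c, of "v @ [i]"] by blast
  qed
  ultimately show "shoot F v \<ggreater> {U}" unfolding gg_def by (metis singletonD)
qed

text \<open>The only node of height \<open>n\<close> whose leaf contains \<open>p\<close> is the
  initial segment of length \<open>n\<close> of the code of \<open>p\<close>, so the condition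
  concerns this single node.\<close>

lemma rise_iff:
  assumes c: "coded_by X F e" and p: "p \<in> topspace X" and "U \<noteq> {}"
  shows "n \<in> rise F p U \<longleftrightarrow>
    (\<exists>E. finite E \<and> (\<forall>x \<in> topspace X. (\<forall>i<n. e x i = e p i) \<and> e x n \<notin> E \<longrightarrow> x \<in> U))"
proof -
  have mem: "x \<in> F (map (e p) [0..<n]) \<longleftrightarrow> x \<in> topspace X \<and> (\<forall>i<n. e x i = e p i)" for x
    by (simp add: coded_by_mem[OF c])
  have "n \<in> rise F p U \<longleftrightarrow> (\<exists>v. n = length v \<and> p \<in> F v \<and> shoot F v \<ggreater> {U})"
    by (simp add: rise_def scope_def height_eq_length)
  also have "\<dots> \<longleftrightarrow> shoot F (map (e p) [0..<n]) \<ggreater> {U}"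
  proof
    assume "\<exists>v. n = length v \<and> p \<in> F v \<and> shoot F v \<ggreater> {U}"
    then obtain v where v: "n = length v" "p \<in> F v" "shoot F v \<ggreater> {U}" by blast
    have "map (e p) [0..<n] = v"
      using v by (intro nth_equalityI) (auto simp: coded_by_mem[OF c])
    then show "shoot F (map (e p) [0..<n]) \<ggreater> {U}" using v(3) by simp
  next
    assume "shoot F (map (e p) [0..<n]) \<ggreater> {U}"
    then show "\<exists>v. n = length v \<and> p \<in> F v \<and> shoot F v \<ggreater> {U}"
      using mem[of p] p by (intro exI[of _ "map (e p) [0..<n]"]) simp
  qed
  also have "\<dots> \<longleftrightarrow> (\<exists>E. finite E \<and> (\<forall>x \<in> F (map (e p) [0..<n]). e x n \<notin> E \<longrightarrow> x \<in> U))"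
    using shoot_gg_iff[OF c \<open>U \<noteq> {}\<close>, of "map (e p) [0..<n]"] by simp
  also have "\<dots> \<longleftrightarrow> (\<exists>E. finite E \<and> (\<forall>x \<in> topspace X. (\<forall>i<n. e x i = e p i) \<and> e x n \<notin> E \<longrightarrow> x \<in> U))"
    by (simp add: Ball_def mem imp_conjL)
  finally show ?thesis .
qed

lemma nbhd_mem: "nbhd X p U \<Longrightarrow> p \<in> U"
  unfolding nbhd_def using interior_of_subset[of X U] by blast

lemma grows_into_iff_rise: "grows_into F X \<longleftrightarrow> (\<forall>p\<in>topspace X. \<forall>U. nbhd X p U \<longrightarrow> rise F p U \<noteq> {})"
  by (fastforce simp: grows_into_def rise_def)

lemma pi_tree_if_coded_by:
  assumes c: "coded_by X F e" and op: "\<And>s. openin X (F s)"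
    and grow: "\<And>p U. p \<in> topspace X \<Longrightarrow> nbhd X p U \<Longrightarrow> rise F p U \<noteq> {}"
  shows "pi_tree X F"
proof -
  have "F [] = topspace X" using coded_by_mem[OF c, of _ "[]"] by auto
  then show ?thesis
    using coded_by_locally_strict[OF c] coded_by_strict_branches[OF c] op grow
    by (simp add: pi_tree_def baire_foliage_tree_def open_foliage_def grows_into_iff_rise)
qed

text \<open>By local strictness each point lies in exactly one leaf per level, and these leaves
  spell out its code. By strict branches each infinite sequence is the code of exactly one
  point.\<close>

lemma baire_foliage_tree_coded_by:
  assumes "baire_foliage_tree X F"
  obtains e where "coded_by X F e"
proof -
  have top: "F [] = topspace X" and ls: "locally_strict F" and sb: "strict_branches F"
    using assms by (auto simp: baire_foliage_tree_def)
  have split: "F s = (\<Union>i. F (s @ [i]))" for s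
    using ls unfolding locally_strict_def sons_eq by (metis image_image)
  have disj: "i = j" if "x \<in> F (s @ [i])" "x \<in> F (s @ [j])" for x s i j
  proof (rule ccontr)
    assume "i \<noteq> j"
    have "disjoint_family_on F (sons s)" using ls unfolding locally_strict_def by blast
    then have "F (s @ [i]) \<inter> F (s @ [j]) = {}"
      by (rule disjoint_family_onD) (use \<open>i \<noteq> j\<close> in \<open>auto simp: sons_eq\<close>)
    then show False using that by blast
  qed
  have mono: "F (s @ t) \<subseteq> F s" for s t
  proof (induction t rule: rev_induct)
    case (snoc i t)
    then show ?case using split[of "s @ t"] by auto
  qed simp
  have uniq: "s = t" if "x \<in> F s" "x \<in> F t" "length s = length t" for x s t
    using that
  proof (induction s arbitrary: t rule: rev_induct)
    case (snoc i s)
    then obtain t' j where t: "t = t' @ [j]" by (cases t rule: rev_cases) auto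
    have "s = t'" using snoc mono by (auto simp: t)
    then show ?case using snoc disj by (auto simp: t)
  qed simp
  have "\<exists>f. \<forall>n. x \<in> F (map f [0..<n])" if "x \<in> topspace X" for x
  proof -
    \<comment> \<open>Descend from the root, at each node passing to a son whose leaf still contains
      \<open>x\<close>.\<close>
    have "\<exists>g. \<forall>n. (x \<in> F (g n) \<and> length (g n) = n) \<and> (\<exists>i. g (Suc n) = g n @ [i])"
    proof (rule dependent_nat_choice)
      show "\<exists>s. x \<in> F s \<and> length s = 0" using that top by auto
    next
      fix s n assume s: "x \<in> F s \<and> length s = n"
      then obtain i where "x \<in> F (s @ [i])" using split[of s] by blast
      then show "\<exists>t. (x \<in> F t \<and> length t = Suc n) \<and> (\<exists>i. t = s @ [i])"
        using s by (intro exI[of _ "s @ [i]"]) simp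
    qed
    then obtain g where g: "\<And>n. x \<in> F (g n)" "\<And>n. length (g n) = n"
      "\<And>n. \<exists>i. g (Suc n) = g n @ [i]" by blast
    define f where "f n = last (g (Suc n))" for n
    have "map f [0..<n] = g n" for n
    proof (induction n)
      case 0
      then show ?case using g(2)[of 0] by simp
    next
      case (Suc n)
      obtain i where "g (Suc n) = g n @ [i]" using g(3) by blast
      then show ?case using Suc by (simp add: f_def)
    qed
    then show ?thesis using g(1) by metis
  qed
  then obtain e where e: "\<And>x n. x \<in> topspace X \<Longrightarrow> x \<in> F (map (e x) [0..<n])" by metis
  have F_iff: "x \<in> F s \<longleftrightarrow> x \<in> topspace X \<and> (\<forall>i<length s. e x i = s ! i)" for x s
  proof
    assume x: "x \<in> F s"
    then have xX: "x \<in> topspace X" using mono[of "[]" s] top by auto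
    then have "map (e x) [0..<length s] = s" using uniq[OF e x] by simp
    then have "e x i = s ! i" if "i < length s" for i
      using that by (metis add_0 nth_map_upt diff_zero)
    then show "x \<in> topspace X \<and> (\<forall>i<length s. e x i = s ! i)" using xX by blast
  next
    assume x: "x \<in> topspace X \<and> (\<forall>i<length s. e x i = s ! i)"
    then have "map (e x) [0..<length s] = s" by (intro nth_equalityI) auto
    then show "x \<in> F s" using e[of x "length s"] x by simp
  qed
  have ex1: "\<exists>q. (\<Inter>n. F (map f [0..<n])) = {q}" for f
    using sb branch_initial_segments[of f] unfolding strict_branches_def by (metis image_image)
  have "bij_betw e (topspace X) UNIV"
    unfolding bij_betw_def
  proof
    show "inj_on e (topspace X)"
    proof (rule inj_onI)
      fix x y assume "x \<in> topspace X" "y \<in> topspace X" "e x = e y"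
      then have "x \<in> (\<Inter>n. F (map (e x) [0..<n]))" "y \<in> (\<Inter>n. F (map (e x) [0..<n]))"
        using e[of x] e[of y] by simp_all
      then show "x = y" using ex1[of "e x"] by (metis singletonD)
    qed
    have "f \<in> e ` topspace X" for f
    proof -
      obtain q where "(\<Inter>n. F (map f [0..<n])) = {q}" using ex1 by blast
      then have q: "q \<in> F (map f [0..<n])" for n by blast
      have "q \<in> topspace X" using q[of 0] top by simp
      moreover have "e q = f"
      proof
        fix n show "e q n = f n" using q[of "Suc n"] by (auto simp: F_iff simp del: upt_Suc)
      qed
      ultimately show ?thesis by blast
    qed
    then show "e ` topspace X = UNIV" by blast
  qed
  then have "coded_by X F e" using F_iff by (auto simp: coded_by_def)
  then show thesis by (rule that)
qed

lemma coded_by_openin_digit: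
  assumes c: "coded_by X F e" and op: "\<And>s. openin X (F s)"
  shows "openin X {x \<in> topspace X. e x n = v}"
proof -
  have "{x \<in> topspace X. e x n = v} = \<Union> (F ` {s. length s = Suc n \<and> s ! n = v})"
  proof (intro set_eqI iffI)
    fix x assume x: "x \<in> {x \<in> topspace X. e x n = v}"
    then have "x \<in> F (map (e x) [0..<Suc n])" by (simp add: coded_by_mem[OF c] del: upt_Suc)
    moreover have "length (map (e x) [0..<Suc n]) = Suc n \<and> map (e x) [0..<Suc n] ! n = v"
      using x by (simp del: upt_Suc)
    ultimately show "x \<in> \<Union> (F ` {s. length s = Suc n \<and> s ! n = v})" by blast
  qed (auto simp: coded_by_mem[OF c])
  then show ?thesis using op by auto
qed

section \<open>Criteria for a \<pi>-tree: labels, digits, families of codes\<close>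

text \<open>The fibres of \<open>P n\<close> are the pieces of level \<open>n\<close>. Every piece
  splits into countably infinitely many pieces of the next level; numbering these turns labels into
  digits. Then \<open>complete\<close> makes the code map surjective, and \<open>sep\<close> makes
  it injective.\<close>

lemma has_pi_tree_if_labels:
  fixes P :: "nat \<Rightarrow> 'c \<Rightarrow> 'd"
  assumes ne: "topspace Z \<noteq> {}"
    and P0: "\<And>z z'. z \<in> topspace Z \<Longrightarrow> z' \<in> topspace Z \<Longrightarrow> P 0 z = P 0 z'"
    and refine: "\<And>n z z'. z \<in> topspace Z \<Longrightarrow> z' \<in> topspace Z
        \<Longrightarrow> P (Suc n) z = P (Suc n) z' \<Longrightarrow> P n z = P n z'"
    and cnt: "\<And>n. countable (P n ` topspace Z)"
    and inf: "\<And>n z. z \<in> topspace Z \<Longrightarrow> infinite (P (Suc n) ` {z' \<in> topspace Z. P n z' = P n z})"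
    and op: "\<And>n z. z \<in> topspace Z \<Longrightarrow> openin Z {z' \<in> topspace Z. P n z' = P n z}"
    and complete: "\<And>f. (\<And>n. f n \<in> topspace Z) \<Longrightarrow> (\<And>n k. n \<le> k \<Longrightarrow> P n (f k) = P n (f n))
        \<Longrightarrow> \<exists>z\<in>topspace Z. \<forall>n. P n z = P n (f n)"
    and sep: "\<And>z z'. z \<in> topspace Z \<Longrightarrow> z' \<in> topspace Z \<Longrightarrow> (\<And>n. P n z = P n z') \<Longrightarrow> z = z'"
    and grow: "\<And>z U. z \<in> topspace Z \<Longrightarrow> nbhd Z z U \<Longrightarrow>
        \<exists>n E. finite E \<and> (\<forall>z'\<in>topspace Z. P n z' = P n z \<and> P (Suc n) z' \<notin> E \<longrightarrow> z' \<in> U)"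
  shows "has_pi_tree Z"
proof -
  \<comment> \<open>The labels of the subpieces of the piece of \<open>z\<close>. This set depends
    only on \<open>P n z\<close>, so points of one piece share the same numbering.\<close>
  define D where "D n z = P (Suc n) ` {z' \<in> topspace Z. P n z' = P n z}" for n z
  define e where "e z n = to_nat_on (D n z) (P (Suc n) z)" for z n
  define F where "F s = {z \<in> topspace Z. \<forall>i<length s. e z i = s ! i}" for s
  have Dcnt: "countable (D n z)" for n z
    by (rule countable_subset[OF _ cnt[of "Suc n"]]) (auto simp: D_def)
  have Dmem: "P (Suc n) z \<in> D n z" if "z \<in> topspace Z" for n z
    using that by (auto simp: D_def)
  have Deq: "D n z' = D n z" if "P n z' = P n z" for n z z'
    using that by (simp add: D_def)
  \<comment> \<open>Sharing the first \<open>n\<close> digits means lying in the same piece of level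
    \<open>n\<close>; hence the leaves of \<open>F\<close> are open.\<close>
  have agree: "(\<forall>i<n. e z' i = e z i) \<longleftrightarrow> P n z' = P n z"
    if "z \<in> topspace Z" "z' \<in> topspace Z" for n z z'
  proof (induction n)
    case 0
    then show ?case using P0[OF that(2,1)] by simp
  next
    case (Suc n)
    have "e z' n = e z n \<longleftrightarrow> P (Suc n) z' = P (Suc n) z" if "P n z' = P n z"
      using Dmem[of z n] Dmem[of z' n] Deq[OF that] Dcnt \<open>z \<in> _\<close> \<open>z' \<in> _\<close>
      by (simp add: e_def)
    then show ?case using Suc refine[OF that(2,1)] by (auto simp: less_Suc_eq)
  qed
  have "bij_betw e (topspace Z) UNIV"
    unfolding bij_betw_def
  proof
    show "inj_on e (topspace Z)"
    proof (rule inj_onI)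
      fix x y assume *: "x \<in> topspace Z" "y \<in> topspace Z" "e x = e y"
      then show "x = y" using agree[OF *(2,1)] by (intro sep) auto
    qed
    have "f \<in> e ` topspace Z" for f
    proof -
      \<comment> \<open>Each \<open>g (Suc n)\<close> stays in the level \<open>n\<close> piece of
        \<open>g n\<close> and moves to the subpiece numbered \<open>f n\<close>, which exists
        because the numbering of an infinite countable set is onto. By \<open>complete\<close> these
        nested pieces have a common point.\<close>
      have "\<exists>g. \<forall>n. g n \<in> topspace Z \<and> (P n (g (Suc n)) = P n (g n) \<and> e (g (Suc n)) n = f n)"
      proof (rule dependent_nat_choice)
        show "\<exists>z. z \<in> topspace Z" using ne by blast
      next
        fix z n assume z: "z \<in> topspace Z"
        have "infinite (D n z)" using inf[OF z] by (simp add: D_def)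
        then obtain a where "a \<in> D n z" "to_nat_on (D n z) a = f n"
          using to_nat_on_surj[OF Dcnt] by blast
        then obtain y where y: "y \<in> topspace Z" "P n y = P n z" "to_nat_on (D n z) (P (Suc n) y) = f n"
          unfolding D_def by blast
        then have "e y n = f n" using Deq[OF y(2)] by (simp add: e_def)
        then show "\<exists>y. y \<in> topspace Z \<and> (P n y = P n z \<and> e y n = f n)" using y by blast
      qed
      then obtain g where g: "\<And>n. g n \<in> topspace Z" "\<And>n. P n (g (Suc n)) = P n (g n)"
        "\<And>n. e (g (Suc n)) n = f n" by blast
      have coarse: "P n x = P n y"
        if "P k x = P k y" "n \<le> k" "x \<in> topspace Z" "y \<in> topspace Z" for n k x y
        using that(2,1)
      proof (induction rule: dec_induct)
        case (step k)
        show ?case using step.IH[OF refine[OF that(3,4) step.prems]] .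
      qed
      have "P n (g k) = P n (g n)" if "n \<le> k" for n k
        using that
      proof (induction rule: dec_induct)
        case (step k)
        then show ?case using coarse[OF g(2)[of k] step(1) g(1) g(1)] by simp
      qed simp
      then obtain z where z: "z \<in> topspace Z" "\<And>n. P n z = P n (g n)"
        using complete[of g] g(1) by blast
      have "e z n = f n" for n
        using agree[OF g(1)[of "Suc n"] z(1), of "Suc n"] z(2) g(3) by auto
      then have "e z = f" by blast
      then show ?thesis using z(1) by blast
    qed
    then show "e ` topspace Z = UNIV" by blast
  qed
  then have c: "coded_by Z F e" by (simp add: coded_by_def F_def)
  have "pi_tree Z F"
  proof (rule pi_tree_if_coded_by[OF c])
    fix s
    have "\<exists>T. openin Z T \<and> z \<in> T \<and> T \<subseteq> F s" if "z \<in> F s" for z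
    proof -
      have z: "z \<in> topspace Z" using that by (simp add: F_def)
      have "{z' \<in> topspace Z. P (length s) z' = P (length s) z} \<subseteq> F s"
      proof
        fix x assume "x \<in> {z' \<in> topspace Z. P (length s) z' = P (length s) z}"
        then have "x \<in> topspace Z" "\<forall>i<length s. e x i = e z i" using agree[OF z] by blast+
        then show "x \<in> F s" using that by (simp add: F_def)
      qed
      then show ?thesis using op[OF z] z by blast
    qed
    then show "openin Z (F s)" by (subst openin_subopen) blast
  next
    fix z U assume z: "z \<in> topspace Z" and U: "nbhd Z z U"
    then obtain n E where E: "finite E"
      "\<And>z'. z' \<in> topspace Z \<Longrightarrow> P n z' = P n z \<Longrightarrow> P (Suc n) z' \<notin> E \<Longrightarrow> z' \<in> U"
      using grow[OF z U] by blast
    \<comment> \<open>The finitely many exceptional labels turn into the finitely many exceptional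
      digits of \<open>rise_iff\<close>.\<close>
    have "z' \<in> U" if "z' \<in> topspace Z" "\<forall>i<n. e z' i = e z i" "e z' n \<notin> to_nat_on (D n z) ` E" for z'
    proof -
      have eq: "P n z' = P n z" using agree[OF z that(1)] that(2) by blast
      then have "P (Suc n) z' \<notin> E" using that(3) unfolding e_def Deq[OF eq] by blast
      then show ?thesis by (rule E(2)[OF that(1) eq])
    qed
    then have "\<forall>z'\<in>topspace Z. (\<forall>i<n. e z' i = e z i) \<and> e z' n \<notin> to_nat_on (D n z) ` E \<longrightarrow> z' \<in> U"
      by simp
    moreover have "U \<noteq> {}" using nbhd_mem[OF U] by auto
    ultimately have "n \<in> rise F z U"
      using finite_imageI[OF E(1)] rise_iff[OF c z] by metis
    then show "rise F z U \<noteq> {}" by blast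
  qed
  then show ?thesis by (auto simp: has_pi_tree_def)
qed

lemma restrict_eq_iff: "restrict f S = restrict g S \<longleftrightarrow> (\<forall>x\<in>S. f x = g x)"
  by (auto simp: fun_eq_iff restrict_def)

text \<open>The digits in \<open>S m\<close> are those fixed at stage \<open>m\<close>, the ones in \<open>N m\<close> are the
  next digits whose minimum is read off. A further position must remain in
  \<open>S (Suc m)\<close>, for otherwise a stage with a single next digit would have only one son.\<close>
lemma has_pi_tree_if_digits:
  fixes c :: "'c \<Rightarrow> 'j \<Rightarrow> nat" and S N :: "nat \<Rightarrow> 'j set"
  assumes S0: "S 0 = {}" and fin: "\<And>m. finite (S m)" and SJ: "(\<Union>m. S m) = J"
    and N: "\<And>m. N m \<noteq> {}" "\<And>m. N m \<inter> S m = {}" "\<And>m. S m \<union> N m \<subset> S (Suc m)"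
    and ex: "\<And>g. \<exists>z\<in>topspace Z. \<forall>j\<in>J. c z j = g j"
    and inj: "\<And>z z'. z \<in> topspace Z \<Longrightarrow> z' \<in> topspace Z \<Longrightarrow> (\<And>j. j \<in> J \<Longrightarrow> c z j = c z' j) \<Longrightarrow> z = z'"
    and op: "\<And>j v. j \<in> J \<Longrightarrow> openin Z {z \<in> topspace Z. c z j = v}"
    and grow: "\<And>z U. z \<in> topspace Z \<Longrightarrow> nbhd Z z U \<Longrightarrow>
        \<exists>m k. \<forall>z'\<in>topspace Z. (\<forall>j\<in>S m. c z' j = c z j) \<and> (\<forall>j\<in>N m. k \<le> c z' j) \<longrightarrow> z' \<in> U"
  shows "has_pi_tree Z"
proof -
  \<comment> \<open>Even indices show the digits in \<open>S m\<close>; odd ones show in addition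
    the minimum of the next digits. The entry 0 only pads the even labels to the same type.\<close>
  define P where "P n z = (restrict (c z) (S (n div 2)), if even n then 0 else Min (c z ` N (n div 2)))"
    for n z
  have P_even: "P (2 * m) z = (restrict (c z) (S m), 0)" for m z by (simp add: P_def)
  have P_odd: "P (Suc (2 * m)) z = (restrict (c z) (S m), Min (c z ` N m))" for m z by (simp add: P_def)
  have parity: "(\<exists>m. n = 2 * m) \<or> (\<exists>m. n = Suc (2 * m))" for n :: nat by presburger
  have SJ': "S m \<subseteq> J" for m using SJ by blast
  have NS: "N m \<subseteq> S (Suc m)" and SS: "S m \<subseteq> S (Suc m)" for m using N(3) by blast+
  have finN: "finite (N m)" for m using NS fin finite_subset by blast
  \<comment> \<open>The digits in \<open>S m\<close> and those in \<open>N m\<close> are all among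
    the digits in \<open>S (Suc m)\<close>.\<close>
  have determined: "P n z' = P n z" if "\<And>j. j \<in> S (Suc (n div 2)) \<Longrightarrow> c z' j = c z j" for n z z'
  proof -
    have "c z' ` N (n div 2) = c z ` N (n div 2)" using that NS by (intro image_cong) auto
    moreover have "restrict (c z') (S (n div 2)) = restrict (c z) (S (n div 2))"
      using that SS by (intro restrict_ext) auto
    ultimately show ?thesis by (simp add: P_def)
  qed
  have box: "openin Z {z' \<in> topspace Z. \<forall>j\<in>Q. c z' j = c z j}" if "finite Q" "Q \<subseteq> J" for Q z
    using that
  proof (induction Q rule: finite_induct)
    case (insert j Q)
    have "{z' \<in> topspace Z. \<forall>j\<in>insert j Q. c z' j = c z j}
        = {z' \<in> topspace Z. c z' j = c z j} \<inter> {z' \<in> topspace Z. \<forall>j\<in>Q. c z' j = c z j}" by auto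
    then show ?case using insert op by auto
  qed simp
  show ?thesis
  proof (rule has_pi_tree_if_labels[of Z P])
    show "topspace Z \<noteq> {}" using ex by blast
    show "P 0 z = P 0 z'" for z z' using S0 by (simp add: P_def restrict_eq_iff)
    show "P n z = P n z'" if "P (Suc n) z = P (Suc n) z'" for n z z'
      using parity[of n]
    proof (elim disjE exE)
      fix m assume "n = 2 * m"
      then show ?thesis using that by (simp add: P_even P_odd)
    next
      fix m assume n: "n = Suc (2 * m)"
      then have "P (2 * Suc m) z = P (2 * Suc m) z'" using that by simp
      then have "\<forall>j\<in>S (Suc m). c z j = c z' j" by (simp only: P_even prod.inject restrict_eq_iff simp_thms)
      then show ?thesis using n by (intro determined) simp
    qed
    show "countable (P n ` topspace Z)" for n
    proof (rule countable_subset)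
      show "P n ` topspace Z \<subseteq> PiE (S (n div 2)) (\<lambda>_. UNIV) \<times> UNIV" by (auto simp: P_def)
      show "countable (PiE (S (n div 2)) (\<lambda>_. UNIV :: nat set) \<times> (UNIV :: nat set))"
        using fin by (intro countable_SIGMA countable_PiE) auto
    qed
    show "infinite (P (Suc n) ` {z' \<in> topspace Z. P n z' = P n z})" if z: "z \<in> topspace Z" for n z
      using parity[of n]
    proof (elim disjE exE)
      fix m assume n: "n = 2 * m"
      have "(restrict (c z) (S m), v) \<in> P (Suc n) ` {z' \<in> topspace Z. P n z' = P n z}" for v
      proof -
        \<comment> \<open>Giving all next digits the same value \<open>v\<close> makes their minimum
          \<open>v\<close>, so every natural number occurs as a minimum inside the piece.\<close>
        obtain z' where z': "z' \<in> topspace Z" "\<And>j. j \<in> J \<Longrightarrow> c z' j = (if j \<in> N m then v else c z j)"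
          using ex[of "\<lambda>j. if j \<in> N m then v else c z j"] by blast
        have "c z' j = c z j" if "j \<in> S m" for j
        proof -
          have "j \<in> J" "j \<notin> N m" using that N(2)[of m] SJ'[of m] by blast+
          then show ?thesis using z'(2) by simp
        qed
        then have r: "restrict (c z') (S m) = restrict (c z) (S m)" by (simp add: restrict_eq_iff)
        have "c z' j = v" if "j \<in> N m" for j
        proof -
          have "j \<in> J" using that NS[of m] SJ'[of "Suc m"] by blast
          then show ?thesis using that z'(2) by simp
        qed
        then have "c z' ` N m = {v}" using N(1)[of m] by auto
        then have "P (Suc n) z' = (restrict (c z) (S m), v)" "P n z' = P n z"
          using r by (simp_all add: n P_odd P_even)
        then show ?thesis using z'(1) by force
      qed
      then have "range (Pair (restrict (c z) (S m))) \<subseteq> P (Suc n) ` {z' \<in> topspace Z. P n z' = P n z}"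
        by blast
      moreover have "infinite (range (Pair (restrict (c z) (S m)) :: nat \<Rightarrow> _))"
        by (rule range_inj_infinite) (simp add: inj_def)
      ultimately show ?thesis using infinite_super by blast
    next
      fix m assume n: "n = Suc (2 * m)"
      \<comment> \<open>The further position: its digit can be varied freely without affecting the
        label \<open>P n\<close>, which sees only \<open>S m\<close> and \<open>N m\<close>.\<close>
      obtain j0 where j0: "j0 \<in> S (Suc m)" "j0 \<notin> S m" "j0 \<notin> N m" using N(3)[of m] by blast
      let ?r = "\<lambda>v. (restrict ((c z)(j0 := v)) (S (Suc m)), 0 :: nat)"
      have "?r v \<in> P (Suc n) ` {z' \<in> topspace Z. P n z' = P n z}" for v
      proof -
        obtain z' where z': "z' \<in> topspace Z" "\<And>j. j \<in> J \<Longrightarrow> c z' j = ((c z)(j0 := v)) j"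
          using ex[of "(c z)(j0 := v)"] by blast
        have "c z' j = c z j" if "j \<in> S m \<union> N m" for j
        proof -
          have "j \<in> J" "j \<noteq> j0" using that j0 SJ'[of "Suc m"] N(3)[of m] by blast+
          then show ?thesis using z'(2) by simp
        qed
        then have "restrict (c z') (S m) = restrict (c z) (S m)" "c z' ` N m = c z ` N m"
          by (simp_all add: restrict_eq_iff)
        then have "P n z' = P n z" by (simp add: n P_odd)
        moreover have "restrict (c z') (S (Suc m)) = restrict ((c z)(j0 := v)) (S (Suc m))"
          unfolding restrict_eq_iff using z'(2) SJ' by blast
        then have "P (Suc n) z' = ?r v"
          using P_even[of "Suc m" z'] by (simp add: n)
        ultimately show ?thesis using z'(1) by force
      qed
      then have "range ?r \<subseteq> P (Suc n) ` {z' \<in> topspace Z. P n z' = P n z}" by blast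
      moreover have "infinite (range ?r)"
        using j0(1) by (intro range_inj_infinite) (auto simp: inj_def restrict_eq_iff)
      ultimately show ?thesis using infinite_super by blast
    qed
    show "openin Z {z' \<in> topspace Z. P n z' = P n z}" if "z \<in> topspace Z" for n z
    proof (subst openin_subopen, intro ballI)
      fix x assume x: "x \<in> {z' \<in> topspace Z. P n z' = P n z}"
      let ?T = "{z' \<in> topspace Z. \<forall>j\<in>S (Suc (n div 2)). c z' j = c x j}"
      have "openin Z ?T" using fin SJ' by (rule box)
      moreover have "?T \<subseteq> {z' \<in> topspace Z. P n z' = P n z}"
      proof
        fix z' assume z': "z' \<in> ?T"
        then have "P n z' = P n x" by (intro determined) blast
        then show "z' \<in> {z' \<in> topspace Z. P n z' = P n z}" using x z' by simp
      qed
      ultimately show "\<exists>T. openin Z T \<and> x \<in> T \<and> T \<subseteq> {z' \<in> topspace Z. P n z' = P n z}"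
        using x by blast
    qed
    show "\<exists>z\<in>topspace Z. \<forall>n. P n z = P n (f n)"
      if f: "\<And>n. f n \<in> topspace Z" "\<And>n k. n \<le> k \<Longrightarrow> P n (f k) = P n (f n)" for f
    proof -
      \<comment> \<open>Digit \<open>j\<close> is taken from the sequence at the first stage that
        fixes it; the coherence of \<open>f\<close> keeps it unchanged from then on.\<close>
      define first where "first j = (LEAST m. j \<in> S m)" for j
      obtain z where z: "z \<in> topspace Z" "\<And>j. j \<in> J \<Longrightarrow> c z j = c (f (2 * first j)) j"
        using ex[of "\<lambda>j. c (f (2 * first j)) j"] by blast
      have "c z j = c (f (2 * M)) j" if "j \<in> S M" for M j
      proof -
        have "first j \<le> M" "j \<in> S (first j)" unfolding first_def using that by (rule Least_le, rule LeastI)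
        then have "\<forall>i\<in>S (first j). c (f (2 * M)) i = c (f (2 * first j)) i"
          using f(2)[of "2 * first j" "2 * M"] by (simp add: P_even restrict_eq_iff)
        then show ?thesis using z(2) SJ' that \<open>j \<in> S (first j)\<close> by auto
      qed
      \<comment> \<open>The index \<open>2 * Suc (n div 2)\<close> is an even index beyond
        \<open>n\<close> whose label shows all digits on which \<open>P n\<close> depends.\<close>
      then have "P n z = P n (f (2 * Suc (n div 2)))" for n by (rule determined)
      moreover have "P n (f (2 * Suc (n div 2))) = P n (f n)" for n by (rule f(2)) presburger
      ultimately show ?thesis using z(1) by auto
    qed
    show "z = z'" if "z \<in> topspace Z" "z' \<in> topspace Z" "\<And>n. P n z = P n z'" for z z'
    proof (rule inj[OF that(1,2)])
      fix j assume "j \<in> J"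
      then obtain m where "j \<in> S m" using SJ by blast
      then show "c z j = c z' j" using that(3)[of "2 * m"] by (simp add: P_even restrict_eq_iff)
    qed
    show "\<exists>n E. finite E \<and> (\<forall>z'\<in>topspace Z. P n z' = P n z \<and> P (Suc n) z' \<notin> E \<longrightarrow> z' \<in> U)"
      if zU: "z \<in> topspace Z" "nbhd Z z U" for z U
    proof -
      obtain m k where mk: "\<And>z'. z' \<in> topspace Z \<Longrightarrow> \<forall>j\<in>S m. c z' j = c z j \<Longrightarrow>
          \<forall>j\<in>N m. k \<le> c z' j \<Longrightarrow> z' \<in> U" using grow[OF zU] by blast
      \<comment> \<open>The labels of subpieces whose minimum is below \<open>k\<close>. Outside
        these finitely many, every next digit is at least \<open>k\<close>.\<close>
      let ?E = "Pair (restrict (c z) (S m)) ` {..<k}"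
      have "z' \<in> U" if z': "z' \<in> topspace Z" "P (2 * m) z' = P (2 * m) z" "P (Suc (2 * m)) z' \<notin> ?E" for z'
      proof (rule mk[OF z'(1)])
        have r: "restrict (c z') (S m) = restrict (c z) (S m)" using z'(2) by (simp add: P_even)
        then show "\<forall>j\<in>S m. c z' j = c z j" by (simp add: restrict_eq_iff)
        have "k \<le> Min (c z' ` N m)" using z'(3) r by (auto simp: P_odd)
        then show "\<forall>j\<in>N m. k \<le> c z' j" using finN N(1) by simp
      qed
      then show ?thesis by (intro exI[of _ "2 * m"] exI[of _ ?E]) auto
    qed
  qed
qed

text \<open>Flattens a family of codes to digits at positions \<open>(i, n)\<close>. Stage
  \<open>m\<close> fixes the positions below \<open>h i m\<close> for \<open>i\<close> in
  \<open>K m\<close>, and the next digits sit at \<open>(i, h i m)\<close>. The assumption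
  \<open>gap\<close> supplies the further position \<open>(i, Suc (h i m))\<close>.\<close>

lemma has_pi_tree_if_codes:
  fixes d :: "'i \<Rightarrow> 'c \<Rightarrow> nat \<Rightarrow> nat" and h :: "'i \<Rightarrow> nat \<Rightarrow> nat" and K :: "nat \<Rightarrow> 'i set"
  assumes fin: "\<And>m. finite (K m)" and K: "\<And>m. K m \<subseteq> K (Suc m)" and KI: "(\<Union>m. K m) = I"
    and h0: "\<And>i. i \<in> I \<Longrightarrow> h i 0 = 0" and h_less: "\<And>i m. i \<in> I \<Longrightarrow> h i m < h i (Suc m)"
    and gap: "\<And>m. \<exists>i\<in>K m. Suc (h i m) < h i (Suc m)"
    and ex: "\<And>g. \<exists>z\<in>topspace Z. \<forall>i\<in>I. d i z = g i"
    and inj: "\<And>z z'. z \<in> topspace Z \<Longrightarrow> z' \<in> topspace Z \<Longrightarrow> (\<And>i. i \<in> I \<Longrightarrow> d i z = d i z') \<Longrightarrow> z = z'"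
    and op: "\<And>i n v. i \<in> I \<Longrightarrow> openin Z {z \<in> topspace Z. d i z n = v}"
    and grow: "\<And>z U. z \<in> topspace Z \<Longrightarrow> nbhd Z z U \<Longrightarrow>
        \<exists>m k. \<forall>z'\<in>topspace Z. (\<forall>i\<in>K m. (\<forall>n<h i m. d i z' n = d i z n) \<and> k \<le> d i z' (h i m)) \<longrightarrow> z' \<in> U"
  shows "has_pi_tree Z"
proof -
  define S where "S m = (SIGMA i:K m. {..<h i m})" for m
  define N where "N m = (\<lambda>i. (i, h i m)) ` K m" for m
  define c where "c z = (\<lambda>(i, n). d i z n)" for z
  have KI': "K m \<subseteq> I" for m using KI by blast
  \<comment> \<open>This bound ensures that every position is fixed at some stage.\<close>
  have h_ge: "m \<le> h i m" if "i \<in> I" for i m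
    by (induction m) (use h_less[OF that] in \<open>simp_all add: Suc_le_eq le_less_trans\<close>)
  have KK: "K m \<subseteq> K n" if "m \<le> n" for m n using K that by (rule lift_Suc_mono_le)
  show ?thesis
  proof (rule has_pi_tree_if_digits[of S "I \<times> UNIV" N Z c])
    show "S 0 = {}" using h0 KI' by (fastforce simp: S_def)
    show "finite (S m)" for m using fin by (simp add: S_def)
    show "(\<Union>m. S m) = I \<times> UNIV"
    proof (intro equalityI subsetI)
      fix x assume "x \<in> I \<times> (UNIV :: nat set)"
      then obtain i n where x: "x = (i, n)" "i \<in> I" by blast
      then obtain m where m: "i \<in> K m" using KI by blast
      have "n < h i (max m (Suc n))" using h_ge[OF x(2), of "max m (Suc n)"] by simp
      moreover have "i \<in> K (max m (Suc n))" using m KK[of m "max m (Suc n)"] by auto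
      ultimately show "x \<in> (\<Union>m. S m)" by (auto simp: S_def x(1))
    qed (use KI' in \<open>auto simp: S_def\<close>)
    show "N m \<noteq> {}" for m using gap[of m] by (auto simp: N_def)
    show "N m \<inter> S m = {}" for m by (auto simp: N_def S_def)
    show "S m \<union> N m \<subset> S (Suc m)" for m
    proof
      have "i \<in> K (Suc m) \<and> h i m < h i (Suc m)" if "i \<in> K m" for i
        using that K KI' h_less by blast
      then show "S m \<union> N m \<subseteq> S (Suc m)" by (fastforce simp: S_def N_def)
      obtain i where i: "i \<in> K m" "Suc (h i m) < h i (Suc m)" using gap by blast
      then have "(i, Suc (h i m)) \<in> S (Suc m)" "(i, Suc (h i m)) \<notin> S m \<union> N m"
        using K by (auto simp: S_def N_def)
      then show "S m \<union> N m \<noteq> S (Suc m)" by blast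
    qed
    show "\<exists>z\<in>topspace Z. \<forall>j\<in>I \<times> UNIV. c z j = g j" for g
      using ex[of "\<lambda>i n. g (i, n)"] by (force simp: c_def)
    show "z = z'" if "z \<in> topspace Z" "z' \<in> topspace Z" "\<And>j. j \<in> I \<times> UNIV \<Longrightarrow> c z j = c z' j" for z z'
    proof (rule inj[OF that(1,2)], rule ext)
      fix i n assume "i \<in> I"
      then show "d i z n = d i z' n" using that(3)[of "(i, n)"] by (simp add: c_def)
    qed
    show "openin Z {z \<in> topspace Z. c z j = v}" if "j \<in> I \<times> UNIV" for j v
      using that op by (auto simp: c_def)
    show "\<exists>m k. \<forall>z'\<in>topspace Z. (\<forall>j\<in>S m. c z' j = c z j) \<and> (\<forall>j\<in>N m. k \<le> c z' j) \<longrightarrow> z' \<in> U"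
      if zU: "z \<in> topspace Z" "nbhd Z z U" for z U
    proof -
      have "(\<forall>j\<in>S m. c z' j = c z j) \<and> (\<forall>j\<in>N m. k \<le> c z' j) \<longleftrightarrow>
          (\<forall>i\<in>K m. (\<forall>n<h i m. d i z' n = d i z n) \<and> k \<le> d i z' (h i m))" for z' m k
        by (auto simp: S_def N_def c_def)
      then show ?thesis using grow[OF zU] by simp
    qed
  qed
qed

section \<open>Levels in the rise sets\<close>

text \<open>A finite set of exceptional digits is bounded, so large digits avoid it. The eventual
  form in \<open>k\<close> allows a common bound for finitely many factors.\<close>

lemma rise_eventually:
  assumes "coded_by X F e" "p \<in> topspace X" "n \<in> rise F p U" "U \<noteq> {}"
  shows "\<forall>\<^sub>F k in sequentially. \<forall>x\<in>topspace X. (\<forall>i<n. e x i = e p i) \<and> k \<le> e x n \<longrightarrow> x \<in> U"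
proof -
  obtain E where E: "finite E" "\<And>x. x \<in> topspace X \<Longrightarrow> (\<forall>i<n. e x i = e p i) \<Longrightarrow> e x n \<notin> E \<Longrightarrow> x \<in> U"
    using assms rise_iff[of X F e p U n] by blast
  obtain b where b: "\<forall>i\<in>E. i < b" using E(1) finite_nat_set_iff_bounded by blast
  have "\<forall>x\<in>topspace X. (\<forall>i<n. e x i = e p i) \<and> k \<le> e x n \<longrightarrow> x \<in> U" if "b \<le> k" for k
    using E(2) b that by (meson leD order_trans)
  then show ?thesis using eventually_sequentially by blast
qed

text \<open>Take for \<open>V\<close> the part of \<open>U\<close> in the level \<open>b\<close>
  leaf around \<open>p\<close>. A level \<open>n < b\<close> cannot serve \<open>V\<close>: changing
  digit \<open>n\<close> of \<open>p\<close> to a fresh value outside the exceptional set gives a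
  point that would have to be in \<open>V\<close> but has left that leaf. So all rise sets are
  unbounded.\<close>

lemma pi_tree_shrink_rise:
  assumes "pi_tree X F" and p: "p \<in> topspace X" and U: "nbhd X p U"
  obtains V where "nbhd X p V" "rise F p V \<noteq> {}" "rise F p V \<subseteq> rise F p U \<inter> {b..}"
proof -
  obtain e where c: "coded_by X F e"
    using assms baire_foliage_tree_coded_by by (auto simp: pi_tree_def)
  have op: "openin X (F s)" for s
    using assms by (auto simp: pi_tree_def baire_foliage_tree_def open_foliage_def)
  define V where "V = U \<inter> F (map (e p) [0..<b])"
  have mem: "x \<in> F (map (e p) [0..<b]) \<longleftrightarrow> x \<in> topspace X \<and> (\<forall>i<b. e x i = e p i)" for x
    by (simp add: coded_by_mem[OF c])
  have nV: "nbhd X p V"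
    using U op mem[of p] p by (auto simp: nbhd_def V_def interior_of_Int interior_of_openin)
  then have "rise F p V \<noteq> {}" using assms p by (auto simp: pi_tree_def grows_into_iff_rise)
  moreover have "n \<in> rise F p U \<and> b \<le> n" if "n \<in> rise F p V" for n
  proof
    have V: "V \<noteq> {}" and U': "U \<noteq> {}" using nbhd_mem[OF nV] nbhd_mem[OF U] by auto
    obtain E where E: "finite E" "\<And>x. x \<in> topspace X \<Longrightarrow> (\<forall>i<n. e x i = e p i) \<Longrightarrow> e x n \<notin> E \<Longrightarrow> x \<in> V"
      using \<open>n \<in> rise F p V\<close> unfolding rise_iff[OF c p V] by blast
    then show "n \<in> rise F p U" unfolding rise_iff[OF c p U'] by (auto simp: V_def)
    show "b \<le> n"
    proof (rule ccontr)
      assume "\<not> b \<le> n"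
      obtain i where i: "i \<notin> insert (e p n) E"
        using E(1) ex_new_if_finite[of "insert (e p n) E"] by auto
      obtain x where x: "x \<in> topspace X" "e x = (e p)(n := i)" using coded_by_surj[OF c] .
      then have "x \<in> V" using i by (intro E(2)) auto
      then have "e x n = e p n" using \<open>\<not> b \<le> n\<close> mem[of x] by (simp add: V_def)
      then show False using x i by simp
    qed
  qed
  ultimately show thesis using that nV by blast
qed

text \<open>A diagonal argument: \<open>h\<close> is eventually inside each member of the countable
  family \<open>\<gamma>\<close>, and every rise set contains such a member.\<close>

lemma almost_all_levels_in_rise:
  assumes pt: "pi_tree X F" and "countable \<gamma>" and fip: "fip \<gamma>" and gg: "\<gamma> \<ggreater> Rise F X"
  obtains h :: "nat \<Rightarrow> nat" where "h 0 = 0" "\<And>m. Suc (h m) < h (Suc m)"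
    "\<And>p U. p \<in> topspace X \<Longrightarrow> nbhd X p U \<Longrightarrow> \<forall>\<^sub>F m in sequentially. h m \<in> rise F p U"
proof -
  obtain e where "coded_by X F e"
    using pt baire_foliage_tree_coded_by by (auto simp: pi_tree_def)
  then obtain p0 where p0: "p0 \<in> topspace X" using coded_by_surj by blast
  \<comment> \<open>Domination is applied to the rise set of a smaller neighbourhood, whose levels
    all lie beyond \<open>b\<close>.\<close>
  have below: "\<exists>G\<in>\<gamma>. G \<subseteq> rise F p U \<inter> {b..}" if pU: "p \<in> topspace X" "nbhd X p U" for p U b
  proof -
    obtain V where "nbhd X p V" "rise F p V \<noteq> {}" "rise F p V \<subseteq> rise F p U \<inter> {b..}"
      using pi_tree_shrink_rise[OF pt pU] .
    moreover have "rise F p V \<in> Rise F X" using calculation(1) pU by (auto simp: Rise_def)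
    ultimately show ?thesis using gg unfolding gg_def by (meson subset_trans)
  qed
  have n0: "nbhd X p0 (topspace X)" using p0 by (simp add: nbhd_def interior_of_topspace)
  have ne: "\<gamma> \<noteq> {}" using below[OF p0 n0] by blast
  define g where "g = from_nat_into \<gamma>"
  have g: "range g = \<gamma>" unfolding g_def using ne \<open>countable \<gamma>\<close> by (rule range_from_nat_into)
  \<comment> \<open>Adding to the first \<open>j + 1\<close> members a member \<open>G\<close>
    inside \<open>{b..}\<close> pushes a common element beyond \<open>b\<close>.\<close>
  have unbdd: "\<exists>n\<in>\<Inter> (g ` {..j}). b \<le> n" for j b
  proof -
    obtain G where G: "G \<in> \<gamma>" "G \<subseteq> {b..}" using below[OF p0 n0, of b] by blast
    have "\<Inter> (insert G (g ` {..j})) \<noteq> {}"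
      using fip G(1) g unfolding fip_def by (metis finite.insertI finite_atMost finite_imageI
        image_subset_iff insert_not_empty insert_subset rangeI)
    then show ?thesis using G(2) by fastforce
  qed
  \<comment> \<open>The start value 0 lies in no prescribed set; it makes stage 0 fix nothing. Steps
    of at least two leave room for the further position of each stage.\<close>
  have "\<exists>h. \<forall>m. (m = 0 \<longrightarrow> h m = 0) \<and> (Suc (h m) < h (Suc m) \<and> h (Suc m) \<in> \<Inter> (g ` {..m}))"
  proof (rule dependent_nat_choice)
    fix x m :: nat
    obtain n where "n \<in> \<Inter> (g ` {..m})" "Suc (Suc x) \<le> n" using unbdd by blast
    then show "\<exists>y. (Suc m = 0 \<longrightarrow> y = 0) \<and> (Suc x < y \<and> y \<in> \<Inter> (g ` {..m}))"
      by (intro exI[of _ n]) auto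
  qed auto
  then obtain h where h: "h 0 = 0" "\<And>m. Suc (h m) < h (Suc m)" "\<And>m. h (Suc m) \<in> \<Inter> (g ` {..m})"
    by blast
  have "\<forall>\<^sub>F m in sequentially. h m \<in> rise F p U" if pU: "p \<in> topspace X" "nbhd X p U" for p U
  proof -
    obtain G where G: "G \<in> \<gamma>" "G \<subseteq> rise F p U" using below[OF pU, of 0] by blast
    then obtain j where j: "G = g j" using g by blast
    have "h m \<in> rise F p U" if "Suc j \<le> m" for m
    proof -
      obtain m' where "m = Suc m'" "j \<le> m'" using \<open>Suc j \<le> m\<close> by (cases m) auto
      then show ?thesis using h(3)[of m'] G(2) j by auto
    qed
    then show ?thesis using eventually_sequentially by blast
  qed
  then show thesis using that h(1,2) by blast
qed

section \<open>Neighbourhoods in the Tychonoff product\<close>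

text \<open>A basic box around \<open>z\<close> inside \<open>W\<close> restricts only finitely many
  factors, and finitely many eventual conditions hold jointly. The bound on \<open>k\<close> comes
  second because the exceptional digits depend on the level \<open>h \<alpha> m\<close>. Having
  almost all \<open>m\<close> leaves the choice of \<open>m\<close> free for a further
  factor.\<close>

lemma product_nbhd_eventually:
  fixes e :: "'i \<Rightarrow> 'a \<Rightarrow> nat \<Rightarrow> nat" and h :: "'i \<Rightarrow> nat \<Rightarrow> nat"
  assumes c: "\<And>\<alpha>. \<alpha> \<in> A \<Longrightarrow> coded_by (X \<alpha>) (F \<alpha>) (e \<alpha>)"
    and h: "\<And>\<alpha> p U. \<alpha> \<in> A \<Longrightarrow> p \<in> topspace (X \<alpha>) \<Longrightarrow> nbhd (X \<alpha>) p U
        \<Longrightarrow> \<forall>\<^sub>F m in sequentially. h \<alpha> m \<in> rise (F \<alpha>) p U"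
    and K: "\<And>\<alpha>. \<alpha> \<in> A \<Longrightarrow> \<forall>\<^sub>F m in sequentially. \<alpha> \<in> K m"
    and W: "openin (product_topology X A) W" "z \<in> W"
  shows "\<forall>\<^sub>F m in sequentially. \<forall>\<^sub>F k in sequentially. \<forall>z'\<in>topspace (product_topology X A).
     (\<forall>\<alpha>\<in>K m. (\<forall>n<h \<alpha> m. e \<alpha> (z' \<alpha>) n = e \<alpha> (z \<alpha>) n) \<and> k \<le> e \<alpha> (z' \<alpha>) (h \<alpha> m)) \<longrightarrow> z' \<in> W"
proof -
  obtain V where V: "finite {\<alpha> \<in> A. V \<alpha> \<noteq> topspace (X \<alpha>)}" "\<And>\<alpha>. \<alpha> \<in> A \<Longrightarrow> openin (X \<alpha>) (V \<alpha>)"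
    "z \<in> Pi\<^sub>E A V" "Pi\<^sub>E A V \<subseteq> W"
    using bspec[OF W(1)[unfolded openin_product_topology_alt] W(2)] by auto
  define Q where "Q = {\<alpha> \<in> A. V \<alpha> \<noteq> topspace (X \<alpha>)}"
  have zV: "z \<alpha> \<in> V \<alpha>" and zX: "z \<alpha> \<in> topspace (X \<alpha>)" if "\<alpha> \<in> A" for \<alpha>
    using V(2)[OF that] V(3) that openin_subset by fastforce+
  have nb: "nbhd (X \<alpha>) (z \<alpha>) (V \<alpha>)" if "\<alpha> \<in> A" for \<alpha>
    using V(2)[OF that] zV[OF that] openin_subset by (auto simp: nbhd_def interior_of_openin)
  have "\<forall>\<^sub>F m in sequentially. \<forall>\<alpha>\<in>Q. \<alpha> \<in> K m \<and> h \<alpha> m \<in> rise (F \<alpha>) (z \<alpha>) (V \<alpha>)"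
    using V(1) unfolding Q_def[symmetric]
  proof (rule eventually_ball_finite, intro ballI eventually_conj)
    fix \<alpha> assume "\<alpha> \<in> Q"
    then have "\<alpha> \<in> A" by (simp add: Q_def)
    then show "\<forall>\<^sub>F m in sequentially. \<alpha> \<in> K m"
      "\<forall>\<^sub>F m in sequentially. h \<alpha> m \<in> rise (F \<alpha>) (z \<alpha>) (V \<alpha>)"
      using K h zX nb by blast+
  qed
  then show ?thesis
  proof (rule eventually_mono)
    fix m assume m: "\<forall>\<alpha>\<in>Q. \<alpha> \<in> K m \<and> h \<alpha> m \<in> rise (F \<alpha>) (z \<alpha>) (V \<alpha>)"
    have "\<forall>\<^sub>F k in sequentially. \<forall>\<alpha>\<in>Q. \<forall>x\<in>topspace (X \<alpha>).
        (\<forall>n<h \<alpha> m. e \<alpha> x n = e \<alpha> (z \<alpha>) n) \<and> k \<le> e \<alpha> x (h \<alpha> m) \<longrightarrow> x \<in> V \<alpha>"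
      using V(1) unfolding Q_def[symmetric]
    proof (rule eventually_ball_finite, intro ballI)
      fix \<alpha> assume \<alpha>: "\<alpha> \<in> Q"
      then have "\<alpha> \<in> A" by (simp add: Q_def)
      then show "\<forall>\<^sub>F k in sequentially. \<forall>x\<in>topspace (X \<alpha>).
        (\<forall>n<h \<alpha> m. e \<alpha> x n = e \<alpha> (z \<alpha>) n) \<and> k \<le> e \<alpha> x (h \<alpha> m) \<longrightarrow> x \<in> V \<alpha>"
        using m \<alpha> zV by (intro rise_eventually[OF c zX]) auto
    qed
    then show "\<forall>\<^sub>F k in sequentially. \<forall>z'\<in>topspace (product_topology X A).
      (\<forall>\<alpha>\<in>K m. (\<forall>n<h \<alpha> m. e \<alpha> (z' \<alpha>) n = e \<alpha> (z \<alpha>) n) \<and> k \<le> e \<alpha> (z' \<alpha>) (h \<alpha> m)) \<longrightarrow> z' \<in> W"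
    proof (rule eventually_mono, intro ballI impI)
      fix k z'
      assume k: "\<forall>\<alpha>\<in>Q. \<forall>x\<in>topspace (X \<alpha>).
          (\<forall>n<h \<alpha> m. e \<alpha> x n = e \<alpha> (z \<alpha>) n) \<and> k \<le> e \<alpha> x (h \<alpha> m) \<longrightarrow> x \<in> V \<alpha>"
        and z': "z' \<in> topspace (product_topology X A)"
          "\<forall>\<alpha>\<in>K m. (\<forall>n<h \<alpha> m. e \<alpha> (z' \<alpha>) n = e \<alpha> (z \<alpha>) n) \<and> k \<le> e \<alpha> (z' \<alpha>) (h \<alpha> m)"
      have "z' \<alpha> \<in> V \<alpha>" if "\<alpha> \<in> A" for \<alpha>
      proof (cases "\<alpha> \<in> Q")
        case True
        then have "z' \<alpha> \<in> topspace (X \<alpha>)" using z'(1) that by auto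
        then show ?thesis using True k z'(2) m by blast
      next
        case False
        then show ?thesis using z'(1) that by (auto simp: Q_def)
      qed
      then have "z' \<in> Pi\<^sub>E A V" using z'(1) by (auto simp: PiE_iff)
      then show "z' \<in> W" using V(4) by blast
    qed
  qed
qed

section \<open>The countable product, alone and with one more factor\<close>

theorem theorem12:
  fixes A :: "'i set" and X :: "'i \<Rightarrow> 'a topology"
    and F :: "'i \<Rightarrow> nat list \<Rightarrow> 'a set" and \<gamma> :: "'i \<Rightarrow> nat set set"
  assumes "A \<noteq> {}" and "countable A"
    and "\<forall>\<alpha>\<in>A. pi_tree (X \<alpha>) (F \<alpha>)"
    and "\<forall>\<alpha>\<in>A. countable (\<gamma> \<alpha>) \<and> fip (\<gamma> \<alpha>) \<and> \<gamma> \<alpha> \<ggreater> Rise (F \<alpha>) (X \<alpha>)"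
  shows "has_pi_tree (product_topology X A)
     \<and> (\<forall>(Y :: 'b topology) G. pi_tree Y G \<and> fip (Rise G Y)
            \<longrightarrow> has_pi_tree (prod_topology Y (product_topology X A)))"
proof -
  let ?Z = "product_topology X A"
  obtain \<alpha>\<^sub>0 where \<alpha>\<^sub>0: "\<alpha>\<^sub>0 \<in> A" using \<open>A \<noteq> {}\<close> by blast
  \<comment> \<open>The factors treated at stage \<open>m\<close>: finitely many, and each one from
    some stage on. The fixed \<open>\<alpha>\<^sub>0\<close> belongs to every stage, so that even
    stage 0 has next digits and a gap.\<close>
  define K where "K m = insert \<alpha>\<^sub>0 {\<alpha> \<in> A. to_nat_on A \<alpha> < m}" for m
  have K_fin: "finite (K m)" for m
  proof -
    have "{\<alpha> \<in> A. to_nat_on A \<alpha> < m} \<subseteq> from_nat_into A ` {..<m}"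
      using \<open>countable A\<close> by (force intro: rev_image_eqI)
    then show ?thesis using finite_surj[of "{..<m}"] by (auto simp: K_def)
  qed
  have K_mono: "K m \<subseteq> K (Suc m)" for m by (auto simp: K_def)
  have K_Un: "(\<Union>m. K m) = A" using \<alpha>\<^sub>0 by (auto simp: K_def)
  have K_ev: "\<forall>\<^sub>F m in sequentially. \<alpha> \<in> K m" if "\<alpha> \<in> A" for \<alpha>
    using eventually_gt_at_top[of "to_nat_on A \<alpha>"] by eventually_elim (simp add: K_def that)
  have "\<exists>e. coded_by (X \<alpha>) (F \<alpha>) e" if "\<alpha> \<in> A" for \<alpha>
    using assms(3) that baire_foliage_tree_coded_by unfolding pi_tree_def by metis
  then obtain e where e: "\<And>\<alpha>. \<alpha> \<in> A \<Longrightarrow> coded_by (X \<alpha>) (F \<alpha>) (e \<alpha>)" by metis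
  have "\<exists>h. h 0 = 0 \<and> (\<forall>m. Suc (h m) < h (Suc m)) \<and>
      (\<forall>p U. p \<in> topspace (X \<alpha>) \<longrightarrow> nbhd (X \<alpha>) p U \<longrightarrow> (\<forall>\<^sub>F m in sequentially. h m \<in> rise (F \<alpha>) p U))"
    if "\<alpha> \<in> A" for \<alpha>
  proof -
    have *: "pi_tree (X \<alpha>) (F \<alpha>)" "countable (\<gamma> \<alpha>)" "fip (\<gamma> \<alpha>)" "\<gamma> \<alpha> \<ggreater> Rise (F \<alpha>) (X \<alpha>)"
      using assms(3,4) that by blast+
    show ?thesis by (rule almost_all_levels_in_rise[OF *]) blast
  qed
  then obtain h where h0: "\<And>\<alpha>. \<alpha> \<in> A \<Longrightarrow> h \<alpha> 0 = 0"
    and h_gap: "\<And>\<alpha> m. \<alpha> \<in> A \<Longrightarrow> Suc (h \<alpha> m) < h \<alpha> (Suc m)"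
    and h_rise: "\<And>\<alpha> p U. \<alpha> \<in> A \<Longrightarrow> p \<in> topspace (X \<alpha>) \<Longrightarrow> nbhd (X \<alpha>) p U
        \<Longrightarrow> \<forall>\<^sub>F m in sequentially. h \<alpha> m \<in> rise (F \<alpha>) p U"
    by metis
  \<comment> \<open>Codes in the different factors can be prescribed independently, since each code
    map is onto.\<close>
  have Z_ex: "\<exists>z\<in>topspace ?Z. \<forall>\<alpha>\<in>A. e \<alpha> (z \<alpha>) = g \<alpha>" for g
  proof -
    have "\<exists>x. x \<in> topspace (X \<alpha>) \<and> e \<alpha> x = g \<alpha>" if "\<alpha> \<in> A" for \<alpha>
      using coded_by_surj[OF e[OF that]] by metis
    then obtain x where "\<And>\<alpha>. \<alpha> \<in> A \<Longrightarrow> x \<alpha> \<in> topspace (X \<alpha>) \<and> e \<alpha> (x \<alpha>) = g \<alpha>" by metis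
    then show ?thesis by (intro bexI[of _ "restrict x A"]) auto
  qed
  have Z_inj: "z = z'"
    if "z \<in> topspace ?Z" "z' \<in> topspace ?Z" "\<And>\<alpha>. \<alpha> \<in> A \<Longrightarrow> e \<alpha> (z \<alpha>) = e \<alpha> (z' \<alpha>)" for z z'
  proof (rule PiE_ext[of _ A "\<lambda>\<alpha>. topspace (X \<alpha>)"])
    fix \<alpha> assume "\<alpha> \<in> A"
    then show "z \<alpha> = z' \<alpha>" using that by (intro coded_by_inj[OF e]) auto
  qed (use that in auto)
  have X_op: "openin (X \<alpha>) {x \<in> topspace (X \<alpha>). e \<alpha> x n = v}" if "\<alpha> \<in> A" for \<alpha> n v
    using assms(3) that by (intro coded_by_openin_digit[OF e])
      (auto simp: pi_tree_def baire_foliage_tree_def open_foliage_def)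
  have Z_op: "openin ?Z {z \<in> topspace ?Z. e \<alpha> (z \<alpha>) n = v}" if "\<alpha> \<in> A" for \<alpha> n v
  proof -
    have "{z \<in> topspace ?Z. e \<alpha> (z \<alpha>) n = v} = {z \<in> topspace ?Z. z \<alpha> \<in> {x \<in> topspace (X \<alpha>). e \<alpha> x n = v}}"
      using that by auto
    then show ?thesis
      by (simp only: openin_continuous_map_preimage[OF
          continuous_map_product_projection[of \<alpha> A X, OF that] X_op[OF that, of n v]])
  qed
  have Z_grow: "\<forall>\<^sub>F m in sequentially. \<forall>\<^sub>F k in sequentially. \<forall>z'\<in>topspace ?Z.
      (\<forall>\<alpha>\<in>K m. (\<forall>n<h \<alpha> m. e \<alpha> (z' \<alpha>) n = e \<alpha> (z \<alpha>) n) \<and> k \<le> e \<alpha> (z' \<alpha>) (h \<alpha> m)) \<longrightarrow> z' \<in> W"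
    if "openin ?Z W" "z \<in> W" for W z
    by (rule product_nbhd_eventually[of A X F e h K, OF _ _ _ that]) (use e h_rise K_ev in blast)+
  have "has_pi_tree ?Z"
  proof (rule has_pi_tree_if_codes[of K A h ?Z "\<lambda>\<alpha> z. e \<alpha> (z \<alpha>)"])
    show "\<exists>\<alpha>\<in>K m. Suc (h \<alpha> m) < h \<alpha> (Suc m)" for m
      using h_gap[OF \<alpha>\<^sub>0] by (auto simp: K_def)
    show "h \<alpha> m < h \<alpha> (Suc m)" if "\<alpha> \<in> A" for \<alpha> m using h_gap[OF that, of m] by simp
    fix z U assume "z \<in> topspace ?Z" "nbhd ?Z z U"
    then obtain W where W: "openin ?Z W" "z \<in> W" "W \<subseteq> U" by (auto simp: nbhd_def interior_of_def)
    obtain m where "\<forall>\<^sub>F k in sequentially. \<forall>z'\<in>topspace ?Z.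
        (\<forall>\<alpha>\<in>K m. (\<forall>n<h \<alpha> m. e \<alpha> (z' \<alpha>) n = e \<alpha> (z \<alpha>) n) \<and> k \<le> e \<alpha> (z' \<alpha>) (h \<alpha> m)) \<longrightarrow> z' \<in> W"
      using eventually_happens'[OF sequentially_bot Z_grow[OF W(1,2)]] by blast
    then obtain k where "\<forall>z'\<in>topspace ?Z.
        (\<forall>\<alpha>\<in>K m. (\<forall>n<h \<alpha> m. e \<alpha> (z' \<alpha>) n = e \<alpha> (z \<alpha>) n) \<and> k \<le> e \<alpha> (z' \<alpha>) (h \<alpha> m)) \<longrightarrow> z' \<in> W"
      using eventually_happens'[OF sequentially_bot] by blast
    then show "\<exists>m k. \<forall>z'\<in>topspace ?Z.
        (\<forall>\<alpha>\<in>K m. (\<forall>n<h \<alpha> m. e \<alpha> (z' \<alpha>) n = e \<alpha> (z \<alpha>) n) \<and> k \<le> e \<alpha> (z' \<alpha>) (h \<alpha> m)) \<longrightarrow> z' \<in> U"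
      using subsetD[OF W(3)] by blast
  qed (fact K_fin K_mono K_Un h0 Z_ex Z_inj Z_op)+
  moreover have "has_pi_tree (prod_topology Y ?Z)" if pt: "pi_tree Y G" for Y :: "'b topology" and G
  proof -
    let ?P = "prod_topology Y ?Z"
    obtain f where f: "coded_by Y G f"
      using pt baire_foliage_tree_coded_by by (auto simp: pi_tree_def)
    \<comment> \<open>The index \<open>None\<close> stands for \<open>Y\<close>, and
      \<open>Some \<alpha>\<close> for the factor \<open>X \<alpha>\<close>.\<close>
    define d where "d = (\<lambda>i (yz :: 'b \<times> ('i \<Rightarrow> 'a)). case i of None \<Rightarrow> f (fst yz) | Some \<alpha> \<Rightarrow> e \<alpha> (snd yz \<alpha>))"
    \<comment> \<open>In \<open>Y\<close> stage \<open>m\<close> uses level \<open>m\<close> itself,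
      so no level of \<open>Y\<close> is skipped. The gap comes from
      \<open>\<alpha>\<^sub>0\<close>.\<close>
    define l where "l = (\<lambda>i. case i of None \<Rightarrow> (\<lambda>m. m) | Some \<alpha> \<Rightarrow> h \<alpha>)"
    show ?thesis
    proof (rule has_pi_tree_if_codes[of "\<lambda>m. insert None (Some ` K m)" "insert None (Some ` A)" l ?P d])
      show "finite (insert None (Some ` K m))" for m using K_fin by simp
      show "insert None (Some ` K m) \<subseteq> insert None (Some ` K (Suc m))" for m using K_mono[of m] by auto
      show "(\<Union>m. insert None (Some ` K m)) = insert None (Some ` A)" using K_Un by auto
      show "l i 0 = 0" if "i \<in> insert None (Some ` A)" for i using that h0 by (auto simp: l_def)
      show "l i m < l i (Suc m)" if "i \<in> insert None (Some ` A)" for i m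
        using that Suc_lessD[OF h_gap] by (auto simp: l_def)
      show "\<exists>i\<in>insert None (Some ` K m). Suc (l i m) < l i (Suc m)" for m
        using h_gap[OF \<alpha>\<^sub>0] by (auto simp: K_def l_def)
      show "\<exists>yz\<in>topspace ?P. \<forall>i\<in>insert None (Some ` A). d i yz = g i" for g
      proof -
        obtain y where "y \<in> topspace Y" "f y = g None" using coded_by_surj[OF f] .
        moreover obtain z where "z \<in> topspace ?Z" "\<forall>\<alpha>\<in>A. e \<alpha> (z \<alpha>) = g (Some \<alpha>)"
          using Z_ex[of "\<lambda>\<alpha>. g (Some \<alpha>)"] by blast
        ultimately show ?thesis by (intro bexI[of _ "(y, z)"]) (auto simp: d_def)
      qed
      show "x = x'" if x: "x \<in> topspace ?P" "x' \<in> topspace ?P"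
        "\<And>i. i \<in> insert None (Some ` A) \<Longrightarrow> d i x = d i x'" for x x'
      proof (rule prod_eqI)
        show "fst x = fst x'" using x(3)[of None] x(1,2) by (intro coded_by_inj[OF f]) (auto simp: d_def)
        have "e \<alpha> (snd x \<alpha>) = e \<alpha> (snd x' \<alpha>)" if "\<alpha> \<in> A" for \<alpha>
          using x(3)[of "Some \<alpha>"] that by (simp add: d_def)
        then show "snd x = snd x'" using x(1,2) by (intro Z_inj) auto
      qed
      show "openin ?P {x \<in> topspace ?P. d i x n = v}" if i: "i \<in> insert None (Some ` A)" for i n v
      proof (cases i)
        case None
        have "openin Y {y \<in> topspace Y. f y n = v}"
          using pt by (intro coded_by_openin_digit[OF f])
            (auto simp: pi_tree_def baire_foliage_tree_def open_foliage_def)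
        moreover have "{x \<in> topspace ?P. d i x n = v} = {y \<in> topspace Y. f y n = v} \<times> topspace ?Z"
          by (auto simp: d_def None)
        ultimately show ?thesis by (simp only: openin_prod_Times_iff openin_topspace simp_thms)
      next
        case (Some \<alpha>)
        then have "\<alpha> \<in> A" using i by auto
        moreover have "{x \<in> topspace ?P. d i x n = v} = topspace Y \<times> {z \<in> topspace ?Z. e \<alpha> (z \<alpha>) n = v}"
          by (auto simp: d_def Some)
        ultimately show ?thesis using Z_op[of \<alpha> n v] by (simp only: openin_prod_Times_iff openin_topspace simp_thms)
      qed
      fix x U assume "x \<in> topspace ?P" and U: "nbhd ?P x U"
      obtain y z where x: "x = (y, z)" by fastforce
      from U obtain T where T: "openin ?P T" "(y, z) \<in> T" "T \<subseteq> U" by (auto simp: nbhd_def interior_of_def x)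
      then obtain V W where V: "openin Y V" "y \<in> V" and W: "openin ?Z W" "z \<in> W" and VW: "V \<times> W \<subseteq> T"
        using T(1)[unfolded openin_prod_topology_alt, rule_format, OF T(2)] by blast
      obtain b where b: "\<And>m. b \<le> m \<Longrightarrow> \<forall>\<^sub>F k in sequentially. \<forall>z'\<in>topspace ?Z.
          (\<forall>\<alpha>\<in>K m. (\<forall>n<h \<alpha> m. e \<alpha> (z' \<alpha>) n = e \<alpha> (z \<alpha>) n) \<and> k \<le> e \<alpha> (z' \<alpha>) (h \<alpha> m)) \<longrightarrow> z' \<in> W"
        using Z_grow[OF W] unfolding eventually_sequentially by blast
      have y: "y \<in> topspace Y" and nV: "nbhd Y y V"
        using V openin_subset by (auto simp: nbhd_def interior_of_openin)
      \<comment> \<open>The product part accepts every stage from \<open>b\<close> on, and the rise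
        set in \<open>Y\<close> has an element beyond \<open>b\<close>; this one stage serves
        both.\<close>
      obtain m where m: "m \<in> rise G y V" "b \<le> m"
        using pi_tree_shrink_rise[OF pt y nV, of b] by blast
      have "V \<noteq> {}" using V(2) by blast
      then have "\<forall>\<^sub>F k in sequentially. \<forall>y'\<in>topspace Y. (\<forall>n<m. f y' n = f y n) \<and> k \<le> f y' m \<longrightarrow> y' \<in> V"
        by (rule rise_eventually[OF f y m(1)])
      \<comment> \<open>With \<open>m\<close> fixed, both conditions hold for all large
        \<open>k\<close>, so a common bound exists.\<close>
      from eventually_happens'[OF sequentially_bot eventually_conj[OF this b[OF m(2)]]]
      obtain k where k: "\<And>y'. y' \<in> topspace Y \<Longrightarrow> (\<forall>n<m. f y' n = f y n) \<Longrightarrow> k \<le> f y' m \<Longrightarrow> y' \<in> V"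
        "\<And>z'. z' \<in> topspace ?Z \<Longrightarrow>
          \<forall>\<alpha>\<in>K m. (\<forall>n<h \<alpha> m. e \<alpha> (z' \<alpha>) n = e \<alpha> (z \<alpha>) n) \<and> k \<le> e \<alpha> (z' \<alpha>) (h \<alpha> m) \<Longrightarrow> z' \<in> W"
        by blast
      have "x' \<in> U" if x': "x' \<in> topspace ?P"
        "\<forall>i\<in>insert None (Some ` K m). (\<forall>n<l i m. d i x' n = d i x n) \<and> k \<le> d i x' (l i m)" for x'
      proof -
        have "fst x' \<in> V" using x' by (intro k(1)) (auto simp: d_def l_def x)
        moreover have "snd x' \<in> W" using x' by (intro k(2)) (auto simp: d_def l_def x)
        ultimately have "x' \<in> V \<times> W" by (simp add: mem_Times_iff)
        then show ?thesis using VW T(3) by blast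
      qed
      then show "\<exists>m k. \<forall>x'\<in>topspace ?P. (\<forall>i\<in>insert None (Some ` K m).
          (\<forall>n<l i m. d i x' n = d i x n) \<and> k \<le> d i x' (l i m)) \<longrightarrow> x' \<in> U" by blast
    qed
  qed
  ultimately show ?thesis by blast
qed

end
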